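(* Let $T$ be a locally finite tree with a fixed root at infinity $\omega\in\partial T$ and reference vertex $o$, in which every vertex has at least one successor. Let $m$ be a flow measure on $T$ and let $\sigma:\mathbb Z\to(0,\infty)$ satisfy $\sum_{n\le k}\sigma(n)<\infty$ for every $k\in\mathbb Z$ and $\sum_{n=0}^\infty \frac{1}{\sigma(n)\,m(p^n(o))}<\infty$. Define $$K(x,y)=\sum_{n=0}^\infty\frac{\Psi(p^{n+1}(x),p^n(x),y)}{S_{n,x}(\sigma)},\qquad x,y\in T.$$ Then $K$ is the reproducing kernel of $B^2(m\cdot\sigma)$; that is, for every $v\in T$, $K(v,\cdot)\in B^2(m\cdot\sigma)$ and $\langle f,K(v,\cdot)\rangle_{L^2(m\cdot\sigma)}=f(v)$ for all $f\in B^2(m\cdot\sigma)$.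
   Context: Tree notation. $T$ is an infinite locally finite tree with graph distance $d$ and a fixed reference vertex $o$. The boundary $\partial T$ is the set of equivalence classes of infinite geodesics starting at $o$ (two being equivalent if they eventually coincide). Fix $\omega\in\partial T$; let $[o,\omega)=\{x_n\}_{n\ge0}$ be the geodesic ray from $o$ (with $x_0=o$) representing $\omega$. The level is $\ell(x)=\lim_{n\to\infty}(n-d(x,x_n))$. For each vertex $x$, $p(x)$ is the unique neighbour with $\ell(p(x))=\ell(x)+1$, and $s(x)$ is the set of the other neighbours (successors). $p^0(x)=x$, $p^n(x)=p(p^{n-1}(x))$; $s_0(x)=\{x\}$, $s_n(x)=\bigcup_{y\in s_{n-1}(x)}s(y)$. It is assumed that $s(x)\neq\emptyset$ for all $x$. $T_x=\bigcup_{n\ge0}s_n(x)$ and $\dot T_x=T_x\setminus\{x\}$. A flow measure is a function $m:T\to(0,\infty)$ with $m(x)=\sum_{y\in s(x)}m(y)$ for all $x$. The associated forward Laplacian is $\Delta f(x)=f(x)-\sum_{y\in s(x)}f(y)\frac{m(y)}{m(x)}$; $f:T\to\mathbb C$ is harmonic if $\Delta f=0$ on $T$. The function $\sigma$ on $\mathbb Z$ is also viewed as a function on $T$ via $\sigma(x)=\sigma(\ell(x))$, and $m\cdot\sigma$ is the measure on $T$ giving mass $m(x)\sigma(x)$ to the vertex $x$. $B^2(m\cdot\sigma)$ is the space of harmonic functions in $L^2(m\cdot\sigma)$, with the $L^2(m\cdot\sigma)$ inner product. For $n\in\mathbb Z$, $x\in T$, set $S_{n,x}(\sigma)=\sum_{k=0}^\infty\sigma(\ell(x)+n-k)$.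 For $v,z,x\in T$ set $\Psi(v,z,x)=0$ if $\{x,z\}\not\subset\dot T_v$; $\Psi(v,z,x)=\frac1{m(y)}-\frac1{m(v)}$ if $\{x,z\}\subset T_y$ for some $y\in s(v)$; and $\Psi(v,z,x)=-\frac1{m(v)}$ otherwise. *)

theory Defs
  imports "HOL-Analysis.Analysis"
begin

text \<open>
  A graph is given by its adjacency relation \<open>E\<close>; its vertex set is the whole type \<open>'a\<close>, which
  stays a type variable in all statements. The reference vertex is called \<open>x0\<close>, since \<open>o\<close> is
  function composition.
\<close>

definition graph_tree :: "('a \<Rightarrow> 'a \<Rightarrow> bool) \<Rightarrow> bool" where
  "graph_tree E \<longleftrightarrow>
     symp E \<and> irreflp E \<and>
     (\<forall>x y. E\<^sup>*\<^sup>* x y) \<and>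
     \<not> (\<exists>xs. 3 \<le> length xs \<and> distinct xs \<and> successively E xs \<and> E (last xs) (hd xs))"

definition locally_finite :: "('a \<Rightarrow> 'a \<Rightarrow> bool) \<Rightarrow> bool" where
  "locally_finite E \<longleftrightarrow> (\<forall>x. finite {y. E x y})"

definition gdist :: "('a \<Rightarrow> 'a \<Rightarrow> bool) \<Rightarrow> 'a \<Rightarrow> 'a \<Rightarrow> nat" where
  "gdist E x y = (LEAST n. (E ^^ n) x y)"

definition geodesic_rays :: "('a \<Rightarrow> 'a \<Rightarrow> bool) \<Rightarrow> 'a \<Rightarrow> (nat \<Rightarrow> 'a) set" where
  "geodesic_rays E x0 =
     {r. r 0 = x0 \<and> (\<forall>i j. int (gdist E (r i) (r j)) = \<bar>int i - int j\<bar>)}"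

definition tree_boundary :: "('a \<Rightarrow> 'a \<Rightarrow> bool) \<Rightarrow> 'a \<Rightarrow> (nat \<Rightarrow> 'a) set set" where
  "tree_boundary E x0 =
     geodesic_rays E x0 //
       {(r, r'). r \<in> geodesic_rays E x0 \<and> r' \<in> geodesic_rays E x0 \<and>
                 (\<exists>N. \<forall>n\<ge>N. r n = r' n)}"

text \<open>
  In a tree, two geodesic rays from \<open>x0\<close> that eventually coincide are equal, so a boundary point
  contains exactly one ray and the description below is well defined.
\<close>

definition end_ray :: "(nat \<Rightarrow> 'a) set \<Rightarrow> nat \<Rightarrow> 'a" where
  "end_ray \<omega> = (THE r. r \<in> \<omega>)"

definition level :: "('a \<Rightarrow> 'a \<Rightarrow> bool) \<Rightarrow> (nat \<Rightarrow> 'a) set \<Rightarrow> 'a \<Rightarrow> int" where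
  "level E \<omega> x = lim (\<lambda>n. int n - int (gdist E x (end_ray \<omega> n)))"

definition parent :: "('a \<Rightarrow> 'a \<Rightarrow> bool) \<Rightarrow> (nat \<Rightarrow> 'a) set \<Rightarrow> 'a \<Rightarrow> 'a" where
  "parent E \<omega> x = (THE y. E x y \<and> level E \<omega> y = level E \<omega> x + 1)"

definition succs :: "('a \<Rightarrow> 'a \<Rightarrow> bool) \<Rightarrow> (nat \<Rightarrow> 'a) set \<Rightarrow> 'a \<Rightarrow> 'a set" where
  "succs E \<omega> x = {y. E x y \<and> y \<noteq> parent E \<omega> x}"

primrec nsuccs :: "('a \<Rightarrow> 'a \<Rightarrow> bool) \<Rightarrow> (nat \<Rightarrow> 'a) set \<Rightarrow> nat \<Rightarrow> 'a \<Rightarrow> 'a set" where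
  "nsuccs E \<omega> 0 x = {x}"
| "nsuccs E \<omega> (Suc n) x = (\<Union>y\<in>nsuccs E \<omega> n x. succs E \<omega> y)"

definition subtree :: "('a \<Rightarrow> 'a \<Rightarrow> bool) \<Rightarrow> (nat \<Rightarrow> 'a) set \<Rightarrow> 'a \<Rightarrow> 'a set" where
  "subtree E \<omega> x = (\<Union>n. nsuccs E \<omega> n x)"

definition proper_subtree :: "('a \<Rightarrow> 'a \<Rightarrow> bool) \<Rightarrow> (nat \<Rightarrow> 'a) set \<Rightarrow> 'a \<Rightarrow> 'a set" where
  "proper_subtree E \<omega> x = subtree E \<omega> x - {x}"

definition flow_measure ::
    "('a \<Rightarrow> 'a \<Rightarrow> bool) \<Rightarrow> (nat \<Rightarrow> 'a) set \<Rightarrow> ('a \<Rightarrow> real) \<Rightarrow> bool" where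
  "flow_measure E \<omega> m \<longleftrightarrow> (\<forall>x. 0 < m x \<and> m x = (\<Sum>y\<in>succs E \<omega> x. m y))"

definition forward_laplacian ::
    "('a \<Rightarrow> 'a \<Rightarrow> bool) \<Rightarrow> (nat \<Rightarrow> 'a) set \<Rightarrow> ('a \<Rightarrow> real) \<Rightarrow> ('a \<Rightarrow> complex) \<Rightarrow> 'a \<Rightarrow> complex" where
  "forward_laplacian E \<omega> m f x =
     f x - (\<Sum>y\<in>succs E \<omega> x. f y * complex_of_real (m y / m x))"

definition harmonic ::
    "('a \<Rightarrow> 'a \<Rightarrow> bool) \<Rightarrow> (nat \<Rightarrow> 'a) set \<Rightarrow> ('a \<Rightarrow> real) \<Rightarrow> ('a \<Rightarrow> complex) \<Rightarrow> bool" where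
  "harmonic E \<omega> m f \<longleftrightarrow> (\<forall>x. forward_laplacian E \<omega> m f x = 0)"

definition weighted_measure ::
    "('a \<Rightarrow> 'a \<Rightarrow> bool) \<Rightarrow> (nat \<Rightarrow> 'a) set \<Rightarrow> ('a \<Rightarrow> real) \<Rightarrow> (int \<Rightarrow> real) \<Rightarrow> 'a measure" where
  "weighted_measure E \<omega> m \<sigma> =
     density (count_space UNIV) (\<lambda>x. ennreal (m x * \<sigma> (level E \<omega> x)))"

definition L2_space :: "'a measure \<Rightarrow> ('a \<Rightarrow> complex) set" where
  "L2_space M = {f \<in> borel_measurable M. integrable M (\<lambda>x. (cmod (f x))\<^sup>2)}"

definition L2_inner :: "'a measure \<Rightarrow> ('a \<Rightarrow> complex) \<Rightarrow> ('a \<Rightarrow> complex) \<Rightarrow> complex" where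
  "L2_inner M f g = (LINT x|M. f x * cnj (g x))"

definition harmonic_bergman ::
    "('a \<Rightarrow> 'a \<Rightarrow> bool) \<Rightarrow> (nat \<Rightarrow> 'a) set \<Rightarrow> ('a \<Rightarrow> real) \<Rightarrow> (int \<Rightarrow> real) \<Rightarrow> ('a \<Rightarrow> complex) set" where
  "harmonic_bergman E \<omega> m \<sigma> =
     {f. harmonic E \<omega> m f \<and> f \<in> L2_space (weighted_measure E \<omega> m \<sigma>)}"

definition level_sum ::
    "('a \<Rightarrow> 'a \<Rightarrow> bool) \<Rightarrow> (nat \<Rightarrow> 'a) set \<Rightarrow> (int \<Rightarrow> real) \<Rightarrow> int \<Rightarrow> 'a \<Rightarrow> real" where
  "level_sum E \<omega> \<sigma> n x = (\<Sum>k. \<sigma> (level E \<omega> x + n - int k))"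

text \<open>
  The subtrees rooted at distinct successors of \<open>v\<close> are disjoint, so the \<open>y\<close> below is unique.
\<close>

definition Psi ::
    "('a \<Rightarrow> 'a \<Rightarrow> bool) \<Rightarrow> (nat \<Rightarrow> 'a) set \<Rightarrow> ('a \<Rightarrow> real) \<Rightarrow> 'a \<Rightarrow> 'a \<Rightarrow> 'a \<Rightarrow> real" where
  "Psi E \<omega> m v z x =
     (if \<not> {x, z} \<subseteq> proper_subtree E \<omega> v then 0
      else if \<exists>y\<in>succs E \<omega> v. {x, z} \<subseteq> subtree E \<omega> y
        then 1 / m (THE y. y \<in> succs E \<omega> v \<and> {x, z} \<subseteq> subtree E \<omega> y) - 1 / m v
      else - (1 / m v))"

definition kernel_term ::
    "('a \<Rightarrow> 'a \<Rightarrow> bool) \<Rightarrow> (nat \<Rightarrow> 'a) set \<Rightarrow> ('a \<Rightarrow> real) \<Rightarrow> (int \<Rightarrow> real) \<Rightarrow> 'a \<Rightarrow> 'a \<Rightarrow> nat \<Rightarrow> real" where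
  "kernel_term E \<omega> m \<sigma> x y n =
     Psi E \<omega> m ((parent E \<omega> ^^ (n + 1)) x) ((parent E \<omega> ^^ n) x) y / level_sum E \<omega> \<sigma> (int n) x"

definition bergman_kernel ::
    "('a \<Rightarrow> 'a \<Rightarrow> bool) \<Rightarrow> (nat \<Rightarrow> 'a) set \<Rightarrow> ('a \<Rightarrow> real) \<Rightarrow> (int \<Rightarrow> real) \<Rightarrow> 'a \<Rightarrow> 'a \<Rightarrow> real" where
  "bergman_kernel E \<omega> m \<sigma> x y = (\<Sum>n. kernel_term E \<omega> m \<sigma> x y n)"

end

theory Submission
  imports Defs
begin

text \<open>
  Write \<open>v\<^sub>n = p\<^sup>n(v)\<close> for the ancestors of \<open>v\<close>, \<open>S(j)\<close> for the sum of \<open>\<sigma>(i)\<close> over \<open>i \<le> j\<close>, and \<open>T\<^sub>x\<close> for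
  the subtree below \<open>x\<close>. For \<open>z\<close> with parent \<open>w\<close>, the function \<open>\<Psi>(w,z,\<cdot>)\<close> is the indicator of
  \<open>T\<^sub>z\<close> minus the indicator of \<open>T\<^sub>w\<close> without its root, each divided by the flow through its
  root (lemma \<open>Psi_eq_bump\<close>). The flow equation makes it harmonic.

  A harmonic \<open>f\<close> satisfies a mean value property on every generation below \<open>x\<close>: the \<open>m\<close>-weighted sum of \<open>f\<close>
  over the descendants of \<open>x\<close> of a given order is \<open>m(x) f(x)\<close>. Hence, for square-integrable \<open>f\<close>,
  the integral of \<open>f\<close> over \<open>T\<^sub>x\<close> is \<open>S(\<ell>(x)) m(x) f(x)\<close> (\<open>integral_desc\<close>). Subtracting two such integrals
  gives \<open>\<langle>f, \<Psi>(w,z,\<cdot>)\<rangle> = S(\<ell>(z)) (f(z) - f(w))\<close> (\<open>inner_bump\<close>). So pairing \<open>f\<close> with the \<open>n\<close>-th term of the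
  kernel yields \<open>f(v\<^sub>n) - f(v\<^sub>n\<^sub>+\<^sub>1)\<close>, and the partial sums telescope to \<open>f(v) - f(v\<^sub>n)\<close> (\<open>inner_block\<close>).

  The same formula, applied to the partial sums themselves, computes their norms without any further
  integration: the block of terms from \<open>i\<close> to \<open>j - 1\<close> has squared norm equal to its value at \<open>v\<^sub>i\<close>, which is
  the sum of \<open>(1/m(v\<^sub>n) - 1/m(v\<^sub>n\<^sub>+\<^sub>1)) / S(\<ell>(v\<^sub>n))\<close> over \<open>i \<le> n < j\<close> (\<open>norm_block\<close>). These numbers are summable because
  \<open>1/m\<close> telescopes along the ancestors and \<open>S\<close> increases. With Fatou's lemma the kernel is in \<open>L\<^sup>2\<close> and is
  the \<open>L\<^sup>2\<close> limit of its partial sums.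

  It remains to see that \<open>f(v\<^sub>n)\<close> tends to \<open>0\<close>. A single vertex \<open>x\<close> contributes \<open>|f(x)|\<^sup>2 m(x) \<sigma>(\<ell>(x))\<close> to the
  squared norm of \<open>f\<close>, and the hypothesis on \<open>1 / (\<sigma>(n) m(p\<^sup>n(o)))\<close> forces \<open>m \<sigma>\<close> to tend to infinity along the
  ancestors of \<open>o\<close>, which are eventually those of \<open>v\<close> (\<open>L2_vanishes_along_ancestors\<close>).
\<close>

section \<open>Distances in a tree\<close>

lemma relpowp_symp:
  assumes "symp E" and "(E ^^ n) x y"
  shows "(E ^^ n) y x"
  using assms(2)
proof (induction n arbitrary: x y)
  case 0
  then show ?case by simp
next
  case (Suc n)
  then obtain z where "(E ^^ n) x z" "E z y" by auto
  then have "E y z" "(E ^^ n) z x"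
    using Suc.IH assms(1) by (auto dest: sympD)
  then show ?case by (rule relpowp_Suc_I2)
qed

locale tree_graph =
  fixes E :: "'a \<Rightarrow> 'a \<Rightarrow> bool"
  assumes tree: "graph_tree E"
begin

abbreviation d :: "'a \<Rightarrow> 'a \<Rightarrow> nat" where "d \<equiv> gdist E"

lemma symp_E: "symp E" and adj_sym: "E x y \<Longrightarrow> E y x" and adj_irrefl: "\<not> E x x"
  and connected: "E\<^sup>*\<^sup>* x y"
  using tree by (auto simp: graph_tree_def dest: sympD irreflpD)

lemma no_cycle: "\<lbrakk>3 \<le> length xs; distinct xs; successively E xs\<rbrakk> \<Longrightarrow> \<not> E (last xs) (hd xs)"
  using tree by (auto simp: graph_tree_def)

lemma relpowp_gdist: "(E ^^ d x y) x y"
proof -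
  obtain n where "(E ^^ n) x y" using connected[of x y] by (auto simp: rtranclp_power)
  then show ?thesis unfolding gdist_def by (rule LeastI)
qed

lemma gdist_le: "(E ^^ n) x y \<Longrightarrow> d x y \<le> n"
  unfolding gdist_def by (rule Least_le)

lemma gdist_commute: "d x y = d y x"
  by (meson relpowp_symp[OF symp_E] gdist_le relpowp_gdist order_antisym)

lemma gdist_triangle: "d x z \<le> d x y + d y z"
  by (rule gdist_le) (auto simp: relpowp_add intro: relpowp_gdist)

lemma gdist_eq_0: "d x y = 0 \<Longrightarrow> x = y"
  using relpowp_gdist[of x y] by simp

lemma gdist_adj: "E x y \<Longrightarrow> d x y = 1"
  using gdist_le[of 1 x y] gdist_eq_0[of x y] adj_irrefl by (cases "d x y") auto

lemma adj_if_gdist_1: "d x y = 1 \<Longrightarrow> E x y"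
  using relpowp_gdist[of x y] by (simp add: OO_def)

lemma closer_neighbour:
  assumes "d x z = Suc n"
  obtains y where "E x y" "d y z = n"
proof -
  have "(E ^^ Suc n) x z" using relpowp_gdist[of x z] assms by simp
  then obtain y where y: "E x y" "(E ^^ n) y z" by (rule relpowp_Suc_E2)
  moreover have "d x z \<le> 1 + d y z" using gdist_triangle[of x z y] gdist_adj[OF y(1)] by simp
  ultimately show thesis using that gdist_le[OF y(2)] assms by force
qed

text \<open>
  Two geodesics descending to \<open>z\<close> are followed until they meet. The resulting path leaves the sphere of
  radius \<open>n\<close> around \<open>z\<close> immediately and never goes beyond it; so it closes up to a cycle as soon as its
  ends are adjacent or have a common neighbour further away from \<open>z\<close>.
\<close>

lemma path_below_sphere:
  assumes "d a z = n" "d b z = n" "a \<noteq> b"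
  shows "\<exists>xs. 3 \<le> length xs \<and> distinct xs \<and> successively E xs \<and> hd xs = a \<and> last xs = b
            \<and> (\<forall>x\<in>set xs. d x z \<le> n)"
  using assms
proof (induction n arbitrary: a b)
  case 0
  then show ?case using gdist_eq_0 by blast
next
  case (Suc n)
  obtain a' where a': "E a a'" "d a' z = n" by (rule closer_neighbour[OF Suc.prems(1)])
  obtain b' where b': "E b b'" "d b' z = n" by (rule closer_neighbour[OF Suc.prems(2)])
  show ?case
  proof (cases "a' = b'")
    case True
    then show ?thesis
      using a' adj_sym[OF b'(1)] b' Suc.prems by (intro exI[of _ "[a, a', b]"]) auto
  next
    case False
    with Suc.IH[OF a'(2) b'(2)] obtain xs where
      xs: "3 \<le> length xs" "distinct xs" "successively E xs" "hd xs = a'" "last xs = b'"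
        "\<forall>x\<in>set xs. d x z \<le> n" by blast
    have "a \<notin> set xs" "b \<notin> set xs" "xs \<noteq> []" using xs Suc.prems by auto
    then show ?thesis
      using xs a' b' Suc.prems adj_sym[OF b'(1)]
      by (intro exI[of _ "a # xs @ [b]"])
        (auto simp: successively_append_iff successively_Cons le_Suc_eq)
  qed
qed

lemma gdist_adj_neq:
  assumes "E a b"
  shows "d a z \<noteq> d b z"
proof
  assume "d a z = d b z"
  moreover have "a \<noteq> b" using assms adj_irrefl by auto
  ultimately obtain xs where "3 \<le> length xs" "distinct xs" "successively E xs" "hd xs = a" "last xs = b"
    using path_below_sphere[of a z "d b z" b] by blast
  then show False using no_cycle[of xs] adj_sym[OF assms] by simp
qed

lemma gdist_adj_cases:
  assumes "E a b"
  shows "d a z = Suc (d b z) \<or> d b z = Suc (d a z)"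
  using gdist_adj_neq[OF assms, of z] gdist_triangle[of a z b] gdist_triangle[of b z a]
    gdist_adj[OF assms] gdist_adj[OF adj_sym[OF assms]] by linarith

text \<open>
  Otherwise \<open>x\<close>, which lies outside the ball of radius \<open>n\<close>, would close the path of
  \<open>path_below_sphere\<close> to a cycle.
\<close>

lemma closer_neighbour_unique:
  assumes "E x a" "E x b" "d a z = n" "d b z = n" "d x z = Suc n"
  shows "a = b"
proof (rule ccontr)
  assume "a \<noteq> b"
  then obtain xs where xs: "3 \<le> length xs" "distinct xs" "successively E xs" "hd xs = a" "last xs = b"
      "\<forall>y\<in>set xs. d y z \<le> n"
    using path_below_sphere[OF assms(3,4)] by blast
  have "x \<notin> set xs" using xs(6) assms(5) by auto
  then show False
    using no_cycle[of "x # xs"] xs assms(1) adj_sym[OF assms(2)]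
    by (cases "xs = []") (auto simp: successively_Cons)
qed

text \<open>
  Backwards from a common vertex, each earlier vertex of either ray is the neighbour closer to \<open>x0\<close>,
  so a boundary point determines its ray.
\<close>

lemma geodesic_ray_unique:
  assumes r: "r \<in> geodesic_rays E x0" and r': "r' \<in> geodesic_rays E x0"
    and ev: "\<forall>n\<ge>N. r n = r' n"
  shows "r = r'"
proof
  fix n
  have dist: "s \<in> geodesic_rays E x0 \<Longrightarrow> d (s n) x0 = n"
     "s \<in> geodesic_rays E x0 \<Longrightarrow> E (s (Suc n)) (s n)" for s n
  proof -
    assume s: "s \<in> geodesic_rays E x0"
    then have "int (d (s n) (s 0)) = \<bar>int n - int 0\<bar>" "s 0 = x0"
      "int (d (s (Suc n)) (s n)) = \<bar>int (Suc n) - int n\<bar>" unfolding geodesic_rays_def by blast+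
    then show "d (s n) x0 = n" "E (s (Suc n)) (s n)" by (auto intro: adj_if_gdist_1)
  qed
  show "r n = r' n"
  proof (cases "N \<le> n")
    case True
    then show ?thesis using ev by blast
  next
    case False
    then have "n \<le> N" by simp
    then show ?thesis
    proof (induction rule: inc_induct)
      case base
      then show ?case using ev by blast
    next
      case (step n)
      show ?case
      proof (rule closer_neighbour_unique[where z = x0])
        show "E (r (Suc n)) (r n)" "E (r (Suc n)) (r' n)"
          using dist(2)[OF r, of n] dist(2)[OF r', of n] step by auto
      qed (use dist(1)[OF r] dist(1)[OF r'] in auto)
    qed
  qed
qed

end

section \<open>Levels and parents\<close>

locale rooted_tree = tree_graph E for E :: "'a \<Rightarrow> 'a \<Rightarrow> bool" +
  fixes x0 :: 'a and \<omega> :: "(nat \<Rightarrow> 'a) set"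
  assumes \<omega>: "\<omega> \<in> tree_boundary E x0"
begin

abbreviation ray :: "nat \<Rightarrow> 'a" where "ray \<equiv> end_ray \<omega>"
abbreviation lev :: "'a \<Rightarrow> int" where "lev \<equiv> level E \<omega>"
abbreviation par :: "'a \<Rightarrow> 'a" where "par \<equiv> parent E \<omega>"

lemma ray: "ray \<in> geodesic_rays E x0"
proof -
  from \<omega> obtain r where r: "r \<in> geodesic_rays E x0"
    and "\<omega> = {(r, r'). r \<in> geodesic_rays E x0 \<and> r' \<in> geodesic_rays E x0 \<and>
                 (\<exists>N. \<forall>n\<ge>N. r n = r' n)} `` {r}"
    unfolding tree_boundary_def by (rule quotientE) blast
  then have "\<omega> = {r}" using geodesic_ray_unique[OF r] by auto
  then show ?thesis using r by (simp add: end_ray_def)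
qed

lemma ray_0: "ray 0 = x0" and gdist_ray: "int (d (ray i) (ray j)) = \<bar>int i - int j\<bar>"
  using ray by (auto simp: geodesic_rays_def)

text \<open>
  These are the sequences whose limits are the levels. They increase with \<open>n\<close> and are bounded, so being
  integer-valued they are eventually constant; levels and distances to far vertices of the ray
  thereby determine each other.
\<close>

definition height :: "'a \<Rightarrow> nat \<Rightarrow> int" where "height x n = int n - int (d x (ray n))"

lemma height_mono: "n \<le> k \<Longrightarrow> height x n \<le> height x k"
proof (induction rule: dec_induct)
  case (step k)
  have "d x (ray (Suc k)) \<le> d x (ray k) + 1"
    using gdist_triangle[of x "ray (Suc k)" "ray k"] gdist_ray[of k "Suc k"] by simp
  with step show ?case by (simp add: height_def)
qed simp

lemma height_le: "height x n \<le> int (d x x0)"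
  using gdist_triangle[of x0 "ray n" x] gdist_ray[of 0 n] ray_0 gdist_commute[of x x0]
  by (simp add: height_def)

lemma level_eventually: "\<exists>N. \<forall>n\<ge>N. height x n = lev x"
proof -
  \<comment> \<open>the defect below the upper bound of \<open>height_le\<close> is a natural number, hence has a minimum\<close>
  define A where "A = range (\<lambda>n. nat (int (d x x0) - height x n))"
  obtain N where N: "nat (int (d x x0) - height x N) = (LEAST k. k \<in> A)"
    using LeastI_ex[of "\<lambda>k. k \<in> A"] unfolding A_def by force
  have "height x n = height x N" if "N \<le> n" for n
  proof -
    have "nat (int (d x x0) - height x N) \<le> nat (int (d x x0) - height x n)"
      unfolding N by (rule Least_le) (simp add: A_def)
    then show ?thesis using height_mono[OF that, of x] height_le[of x n] height_le[of x N] by simp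
  qed
  then have const: "\<forall>n\<ge>N. height x n = height x N" by blast
  then have "(height x) \<longlonglongrightarrow> height x N"
    by (intro tendsto_eventually) (unfold eventually_sequentially, blast)
  then have "lim (height x) = height x N" by (rule limI)
  moreover have "lev x = lim (height x)" by (simp only: level_def height_def[abs_def])
  ultimately have "lev x = height x N" by simp
  with const show ?thesis by metis
qed

lemma level_adj:
  assumes "E x y"
  shows "lev y = lev x + 1 \<or> lev y = lev x - 1"
proof -
  obtain N M where N: "\<forall>n\<ge>N. height x n = lev x" and M: "\<forall>n\<ge>M. height y n = lev y"
    using level_eventually by meson
  have "height x (max N M) = lev x" "height y (max N M) = lev y" using N M by auto
  then show ?thesis
    using gdist_adj_cases[OF assms, of "ray (max N M)"] unfolding height_def by linarith
qed

text \<open>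
  A neighbour of \<open>x\<close> has level one more than \<open>x\<close> exactly if it is closer to all far vertices of the ray.
  One closer neighbour exists for a single far vertex, which suffices because heights increase.
\<close>

lemma parent_ex1: "\<exists>!y. E x y \<and> lev y = lev x + 1"
proof -
  obtain N where N: "\<forall>n\<ge>N. height x n = lev x" using level_eventually by blast
  show ?thesis
  proof (rule ex_ex1I)
    define n where "n = max N (nat (lev x + 1))"
    have hx: "height x n = lev x" using N by (simp add: n_def)
    then have "d x (ray n) \<noteq> 0" unfolding n_def height_def by linarith
    then obtain k where k: "d x (ray n) = Suc k" using not0_implies_Suc by blast
    obtain y where y: "E x y" "d y (ray n) = k" by (rule closer_neighbour[OF k])
    have "height y n = lev x + 1" using hx k y by (simp add: height_def)
    moreover obtain M where "\<forall>k\<ge>M. height y k = lev y" using level_eventually by blast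
    then have "height y (max n M) = lev y" by simp
    then have "height y n \<le> lev y" using height_mono[of n "max n M" y] by simp
    ultimately have "lev y = lev x + 1" using level_adj[OF y(1)] by linarith
    with y(1) show "\<exists>y. E x y \<and> lev y = lev x + 1" by blast
  next
    fix a b assume a: "E x a \<and> lev a = lev x + 1" and b: "E x b \<and> lev b = lev x + 1"
    obtain A where A: "\<forall>n\<ge>A. height a n = lev a" using level_eventually by blast
    obtain B where B: "\<forall>n\<ge>B. height b n = lev b" using level_eventually by blast
    define n where "n = max N (max A B)"
    have "height a n = lev x + 1" "height b n = lev x + 1" "height x n = lev x"
      using a b A B N by (auto simp: n_def)
    then have "d a (ray n) = d b (ray n)" "d x (ray n) = Suc (d b (ray n))"
      unfolding height_def by linarith+
    then show "a = b" using closer_neighbour_unique[of x a b] a b by blast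
  qed
qed

lemma adj_parent: "E x (par x)" and level_parent: "lev (par x) = lev x + 1"
  using theI'[OF parent_ex1[of x]] unfolding parent_def by blast+

lemma parent_eq: "E x y \<Longrightarrow> lev y = lev x + 1 \<Longrightarrow> par x = y"
  unfolding parent_def by (rule the1_equality[OF parent_ex1]) simp

lemma succs_eq: "succs E \<omega> x = {y. par y = x}"
proof (intro set_eqI iffI)
  fix y assume y: "y \<in> succs E \<omega> x"
  then have "E x y" "lev y \<noteq> lev x + 1" using parent_eq[of x y] by (auto simp: succs_def)
  then show "y \<in> {y. par y = x}" using level_adj[of x y] parent_eq[of y x] adj_sym[of x y] by auto
next
  fix y assume "y \<in> {y. par y = x}"
  then have "x = par y" by simp
  then show "y \<in> succs E \<omega> x"
    using adj_sym[OF adj_parent[of y]] level_parent[of y] level_parent[of x] by (auto simp: succs_def)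
qed

text \<open>
  Along a path each step goes to the parent or to a child, so the ancestral lines of adjacent vertices
  coincide from some point on.
\<close>

lemma tree_common_ancestor: "\<exists>i j. (par ^^ i) x = (par ^^ j) y"
  using connected[of x y]
proof (induction rule: rtranclp_induct)
  case base
  then show ?case by (intro exI[of _ 0]) simp
next
  case (step y z)
  then obtain i j where ij: "(par ^^ i) x = (par ^^ j) y" by blast
  consider "par y = z" | "par z = y"
    using level_adj[OF step(2)] parent_eq[OF step(2)] parent_eq[OF adj_sym[OF step(2)]] by force
  then show ?case
  proof cases
    case 1
    have "(par ^^ Suc i) x = par ((par ^^ j) y)" using ij by simp
    also have "\<dots> = (par ^^ j) z" using 1 by (simp add: funpow_swap1)
    finally show ?thesis by blast
  next
    case 2
    then have "(par ^^ i) x = (par ^^ Suc j) z" using ij by (simp add: funpow_swap1)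
    then show ?thesis by blast
  qed
qed

lemma level_x0: "lev x0 = 0"
proof -
  obtain N where "\<forall>n\<ge>N. height x0 n = lev x0" using level_eventually by blast
  then have "height x0 N = lev x0" by blast
  then show ?thesis using gdist_ray[of 0 N] ray_0 by (simp add: height_def)
qed

lemma nsuccs_eq: "nsuccs E \<omega> n x = {y. (par ^^ n) y = x}"
  by (induction n) (auto simp: succs_eq funpow_swap1)

end

section \<open>Square-integrable functions\<close>

lemma integrable_mult_cnj_L2:
  assumes "f \<in> L2_space M" "g \<in> L2_space M"
  shows "integrable M (\<lambda>x. f x * cnj (g x))"
proof (rule Bochner_Integration.integrable_bound)
  show "integrable M (\<lambda>x. (cmod (f x))\<^sup>2 + (cmod (g x))\<^sup>2)"
    using assms by (simp add: L2_space_def)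
  have [measurable]: "f \<in> borel_measurable M" "g \<in> borel_measurable M"
    using assms by (simp_all add: L2_space_def)
  show "(\<lambda>x. f x * cnj (g x)) \<in> borel_measurable M"
    by (intro borel_measurable_times borel_measurable_continuous_on[OF continuous_on_cnj]) auto
  have "cmod (f x * cnj (g x)) \<le> norm ((cmod (f x))\<^sup>2 + (cmod (g x))\<^sup>2)" for x
    using sum_squares_bound[of "cmod (f x)" "cmod (g x)"]
      mult_nonneg_nonneg[of "cmod (f x)" "cmod (g x)"]
    by (simp add: norm_mult del: mult_nonneg_nonneg)
  then show "AE x in M. norm (f x * cnj (g x)) \<le> norm ((cmod (f x))\<^sup>2 + (cmod (g x))\<^sup>2)" by simp
qed

lemma L2_add:
  assumes "f \<in> L2_space M" "g \<in> L2_space M"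
  shows "(\<lambda>x. f x + g x) \<in> L2_space M"
proof -
  have [measurable]: "f \<in> borel_measurable M" "g \<in> borel_measurable M"
    using assms by (simp_all add: L2_space_def)
  have "integrable M (\<lambda>x. (cmod (f x + g x))\<^sup>2)"
  proof (rule Bochner_Integration.integrable_bound)
    show "integrable M (\<lambda>x. 2 * (cmod (f x))\<^sup>2 + 2 * (cmod (g x))\<^sup>2)"
      using assms by (simp add: L2_space_def)
    have "(cmod (f x + g x))\<^sup>2 \<le> 2 * (cmod (f x))\<^sup>2 + 2 * (cmod (g x))\<^sup>2" for x
    proof -
      have "(cmod (f x + g x))\<^sup>2 \<le> (cmod (f x) + cmod (g x))\<^sup>2"
        by (intro power_mono norm_triangle_ineq) auto
      also have "\<dots> \<le> 2 * (cmod (f x))\<^sup>2 + 2 * (cmod (g x))\<^sup>2"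
        using sum_squares_bound[of "cmod (f x)" "cmod (g x)"] by (simp add: power2_sum)
      finally show ?thesis .
    qed
    then show "AE x in M. norm ((cmod (f x + g x))\<^sup>2) \<le> norm (2 * (cmod (f x))\<^sup>2 + 2 * (cmod (g x))\<^sup>2)"
      by simp
  qed simp
  then show ?thesis by (simp add: L2_space_def)
qed

lemma L2_cmult: "f \<in> L2_space M \<Longrightarrow> (\<lambda>x. c * f x) \<in> L2_space M"
  by (auto simp: L2_space_def norm_mult power_mult_distrib)

lemma L2_zero: "(\<lambda>x. 0) \<in> L2_space M"
  by (simp add: L2_space_def)

lemma L2_sum: "(\<And>n. n \<in> I \<Longrightarrow> g n \<in> L2_space M) \<Longrightarrow> (\<lambda>x. \<Sum>n\<in>I. g n x) \<in> L2_space M"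
  by (induction I rule: infinite_finite_induct) (auto intro: L2_add simp: L2_zero)

text \<open>
  A weighted Young inequality; optimising over \<open>t\<close> would give Cauchy-Schwarz up to a constant, and
  the free parameter serves as well for passing to the limit.
\<close>

lemma L2_inner_bound:
  assumes "f \<in> L2_space M" "g \<in> L2_space M" "0 < t"
  shows "cmod (L2_inner M f g) \<le> t * (\<integral>x. (cmod (f x))\<^sup>2 \<partial>M) + (\<integral>x. (cmod (g x))\<^sup>2 \<partial>M) / t"
proof -
  have int: "integrable M (\<lambda>x. (cmod (f x))\<^sup>2)" "integrable M (\<lambda>x. (cmod (g x))\<^sup>2)"
    using assms by (simp_all add: L2_space_def)
  have "cmod (L2_inner M f g) \<le> (\<integral>x. cmod (f x * cnj (g x)) \<partial>M)"
    unfolding L2_inner_def by (rule integral_norm_bound)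
  also have "\<dots> \<le> (\<integral>x. t * (cmod (f x))\<^sup>2 + (cmod (g x))\<^sup>2 / t \<partial>M)"
  proof (rule integral_mono)
    show "integrable M (\<lambda>x. cmod (f x * cnj (g x)))"
      by (intro integrable_norm integrable_mult_cnj_L2 assms)
    show "integrable M (\<lambda>x. t * (cmod (f x))\<^sup>2 + (cmod (g x))\<^sup>2 / t)"
      using int by simp
    fix x
    have "0 \<le> (t * cmod (f x) - cmod (g x))\<^sup>2" by simp
    then have "2 * (t * (cmod (f x) * cmod (g x))) \<le> t\<^sup>2 * (cmod (f x))\<^sup>2 + (cmod (g x))\<^sup>2"
      by (simp add: power2_diff power_mult_distrib algebra_simps)
    moreover have "0 \<le> t * (cmod (f x) * cmod (g x))" using assms(3) by simp
    ultimately have "t * (cmod (f x) * cmod (g x)) \<le> t\<^sup>2 * (cmod (f x))\<^sup>2 + (cmod (g x))\<^sup>2"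
      by linarith
    also have "\<dots> = t * (t * (cmod (f x))\<^sup>2 + (cmod (g x))\<^sup>2 / t)"
      using assms(3) by (simp add: field_simps power2_eq_square)
    finally show "cmod (f x * cnj (g x)) \<le> t * (cmod (f x))\<^sup>2 + (cmod (g x))\<^sup>2 / t"
      using assms(3) by (simp add: norm_mult)
  qed
  also have "\<dots> = t * (\<integral>x. (cmod (f x))\<^sup>2 \<partial>M) + (\<integral>x. (cmod (g x))\<^sup>2 \<partial>M) / t"
    using int by simp
  finally show ?thesis .
qed

section \<open>Flows and harmonic functions\<close>

text \<open>
  From here on the tree is seen only through parents and levels. Children are the fibres of \<open>par\<close>, and
  connectedness enters as the existence of common ancestors.
\<close>

locale horocyclic_flow =
  fixes par :: "'a \<Rightarrow> 'a" and lev :: "'a \<Rightarrow> int" and m :: "'a \<Rightarrow> real" and \<sigma> :: "int \<Rightarrow> real"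
  assumes lev_par: "lev (par x) = lev x + 1"
    and finite_children: "finite {y. par y = x}"
    and common_ancestor: "\<exists>i j. (par ^^ i) x = (par ^^ j) y"
    and m_pos: "0 < m x"
    and flow: "m x = (\<Sum>y | par y = x. m y)"
    and \<sigma>_pos: "0 < \<sigma> n"
    and \<sigma>_summable: "summable (\<lambda>k. \<sigma> (n - int k))"
begin

definition S :: "int \<Rightarrow> real" where "S n = (\<Sum>k. \<sigma> (n - int k))"

definition M :: "'a measure" where
  "M = density (count_space UNIV) (\<lambda>x. ennreal (m x * \<sigma> (lev x)))"

text \<open>
  Harmonicity is multiplied through by \<open>m x\<close>, which leaves a plain sum over children.
\<close>

definition Harm :: "('a \<Rightarrow> complex) \<Rightarrow> bool" where
  "Harm f \<longleftrightarrow> (\<forall>x. of_real (m x) * f x = (\<Sum>y | par y = x. of_real (m y) * f y))"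

definition gen :: "nat \<Rightarrow> 'a \<Rightarrow> 'a set" where "gen n x = {y. (par ^^ n) y = x}"

definition desc :: "'a \<Rightarrow> 'a set" where "desc x = (\<Union>n. gen n x)"

text \<open>
  This is the function \<open>\<Psi>(p(z), z, \<cdot>)\<close> in closed form.
\<close>

definition bump :: "'a \<Rightarrow> 'a \<Rightarrow> real" where
  "bump z y = indicator (desc z) y / m z - indicator (desc (par z) - {par z}) y / m (par z)"

lemma measurable_M [measurable, simp]: "f \<in> borel_measurable M" "A \<in> sets M" "space M = UNIV"
  by (auto simp: M_def)

lemma m_nonneg [simp]: "0 \<le> m x" and \<sigma>_nonneg [simp]: "0 \<le> \<sigma> n"
  and m_neq_0 [simp]: "m x \<noteq> 0"
  using m_pos[of x] \<sigma>_pos[of n] by auto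

lemma lev_funpow: "lev ((par ^^ n) x) = lev x + int n"
  by (induction n) (auto simp: lev_par)

lemma lev_gen: "y \<in> gen n x \<Longrightarrow> lev y = lev x - int n"
  using lev_funpow[of n y] by (simp add: gen_def)

lemma gen_0: "gen 0 x = {x}" by (auto simp: gen_def)

lemma gen_Suc: "gen (Suc n) x = (\<Union>y\<in>gen n x. {z. par z = y})"
  by (auto simp: gen_def funpow_swap1)

lemma finite_gen: "finite (gen n x)"
  by (induction n) (auto simp: gen_0 gen_Suc finite_children)

lemma disjoint_gen: "i \<noteq> j \<Longrightarrow> gen i x \<inter> gen j x = {}"
proof (rule ccontr)
  assume "i \<noteq> j" "gen i x \<inter> gen j x \<noteq> {}"
  then obtain y where "y \<in> gen i x" "y \<in> gen j x" by blast
  then have "lev x - int i = lev x - int j" using lev_gen[of y] by metis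
  with \<open>i \<noteq> j\<close> show False by simp
qed

lemma desc_self: "x \<in> desc x"
  unfolding desc_def using gen_0[of x] by blast

lemma lev_desc: "y \<in> desc x \<Longrightarrow> lev y \<le> lev x"
proof -
  assume "y \<in> desc x"
  then obtain n where "y \<in> gen n x" by (auto simp: desc_def)
  from lev_gen[OF this] show ?thesis by simp
qed

lemma desc_par: "y \<in> desc x \<longleftrightarrow> y = x \<or> par y \<in> desc x"
proof
  assume "y \<in> desc x"
  then obtain n where n: "(par ^^ n) y = x" by (auto simp: desc_def gen_def)
  show "y = x \<or> par y \<in> desc x"
  proof (cases n)
    case 0
    then show ?thesis using n by simp
  next
    case (Suc k)
    then have "par y \<in> gen k x" using n by (simp add: gen_def funpow_swap1)
    then show ?thesis by (auto simp: desc_def)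
  qed
next
  have "y \<in> desc x" if "par y \<in> desc x"
  proof -
    from that obtain n where "(par ^^ n) (par y) = x" by (auto simp: desc_def gen_def)
    then have "y \<in> gen (Suc n) x" by (simp add: gen_def funpow_swap1)
    then show ?thesis unfolding desc_def by blast
  qed
  then show "y = x \<or> par y \<in> desc x \<Longrightarrow> y \<in> desc x" using desc_self by blast
qed

lemma desc_subset_par: "desc z \<subseteq> desc (par z)"
proof
  fix y assume "y \<in> desc z"
  then obtain n where "(par ^^ n) y = z" by (auto simp: desc_def gen_def)
  then have "y \<in> gen (Suc n) (par z)" by (simp add: gen_def)
  then show "y \<in> desc (par z)" unfolding desc_def by blast
qed

lemma par_notin_desc: "par z \<notin> desc z"
  using lev_desc[of "par z" z] by (auto simp: lev_par)

lemma funpow_in_desc: "(par ^^ i) x \<in> desc ((par ^^ (i + k)) x)"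
proof -
  have "(par ^^ i) x \<in> gen k ((par ^^ (i + k)) x)"
    by (simp add: gen_def add.commute[of i] funpow_add)
  then show ?thesis unfolding desc_def by blast
qed

text \<open>
  The mean value property over a generation, by iterating the one over children.
\<close>

lemma Harm_gen:
  assumes "Harm f"
  shows "(\<Sum>y\<in>gen n x. of_real (m y) * f y) = of_real (m x) * f x"
proof (induction n)
  case 0
  then show ?case by (simp add: gen_0)
next
  case (Suc n)
  have "(\<Sum>y\<in>gen (Suc n) x. of_real (m y) * f y) = (\<Sum>y\<in>gen n x. \<Sum>z | par z = y. of_real (m z) * f z)"
    unfolding gen_Suc by (rule sum.UNION_disjoint) (auto simp: finite_gen finite_children)
  also have "\<dots> = (\<Sum>y\<in>gen n x. of_real (m y) * f y)"
    by (simp add: assms[unfolded Harm_def, rule_format, symmetric])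
  finally show ?case using Suc by simp
qed

lemma integral_finite:
  fixes f :: "'a \<Rightarrow> 'b::{banach, second_countable_topology}"
  assumes "finite A"
  shows "(LINT y:A|M. f y) = (\<Sum>y\<in>A. (m y * \<sigma> (lev y)) *\<^sub>R f y)"
proof -
  let ?g = "\<lambda>y. (m y * \<sigma> (lev y)) *\<^sub>R indicator A y *\<^sub>R f y"
  have "(LINT y:A|M. f y) = (\<integral>y. ?g y \<partial>count_space UNIV)"
    unfolding set_lebesgue_integral_def M_def by (subst integral_density) auto
  also have "\<dots> = (\<Sum>y | y \<in> UNIV \<and> ?g y \<noteq> 0. ?g y)"
    by (rule lebesgue_integral_count_space_finite_support)
      (rule finite_subset[OF _ assms], auto split: split_indicator_asm)
  also have "\<dots> = (\<Sum>y\<in>A. ?g y)"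
    using assms by (intro sum.mono_neutral_left) (auto split: split_indicator_asm)
  also have "\<dots> = (\<Sum>y\<in>A. (m y * \<sigma> (lev y)) *\<^sub>R f y)" by (intro sum.cong) auto
  finally show ?thesis .
qed

lemma Harm_1: "Harm (\<lambda>_. 1)"
  unfolding Harm_def by (simp add: flow[symmetric] flip: of_real_sum)

text \<open>
  The mean value property of the constant \<open>1\<close> says that every generation below \<open>x\<close> carries the same
  flow as \<open>x\<close>.
\<close>

lemma emeasure_gen: "emeasure M (gen n x) = ennreal (m x * \<sigma> (lev x - int n))"
proof -
  have "emeasure M (gen n x) = (\<Sum>y\<in>gen n x. ennreal (m y * \<sigma> (lev y)))"
    unfolding M_def
    by (subst emeasure_density) (auto simp: nn_integral_count_space_indicator[symmetric] nn_integral_count_space_finite finite_gen)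
  also have "\<dots> = ennreal (\<Sum>y\<in>gen n x. m y * \<sigma> (lev x - int n))"
    by (simp add: sum_ennreal lev_gen)
  also have "(\<Sum>y\<in>gen n x. m y * \<sigma> (lev x - int n)) = m x * \<sigma> (lev x - int n)"
  proof -
    have "complex_of_real (\<Sum>y\<in>gen n x. m y) = complex_of_real (m x)"
      using Harm_gen[OF Harm_1, of n x] by simp
    then have "(\<Sum>y\<in>gen n x. m y) = m x" by (simp only: of_real_eq_iff)
    then show ?thesis by (simp flip: sum_distrib_right)
  qed
  finally show ?thesis .
qed

lemma finite_measure_desc: "emeasure M (desc x) < \<infinity>"
proof -
  have "emeasure M (desc x) = (\<Sum>n. emeasure M (gen n x))"
    unfolding desc_def by (rule suminf_emeasure[symmetric]) (auto simp: disjoint_family_on_def disjoint_gen)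
  also have "\<dots> = ennreal (\<Sum>n. m x * \<sigma> (lev x - int n))"
    unfolding emeasure_gen by (rule suminf_ennreal2) (auto intro: summable_mult \<sigma>_summable)
  finally show ?thesis by simp
qed

lemma L2_integrable_desc:
  assumes "f \<in> L2_space M"
  shows "set_integrable M (desc x) f"
  unfolding set_integrable_def
proof (rule Bochner_Integration.integrable_bound)
  show "integrable M (\<lambda>y. indicator (desc x) y + (cmod (f y))\<^sup>2)"
    using assms finite_measure_desc[of x]
    by (intro Bochner_Integration.integrable_add) (auto simp: L2_space_def integrable_indicator_iff)
  have "cmod (f y) \<le> 1 + (cmod (f y))\<^sup>2" for y
    using sum_squares_bound[of "cmod (f y)" 1] zero_le_power2[of "cmod (f y)"]
    unfolding one_power2 mult_1_right by linarith
  then show "AE y in M. norm (indicator (desc x) y *\<^sub>R f y) \<le> norm (indicator (desc x) y + (cmod (f y))\<^sup>2)"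
    by (auto split: split_indicator)
qed simp

text \<open>
  The mean value property over a whole subtree: the generation of order \<open>n\<close> lies on one level, so it
  contributes the mean value weighted by \<open>\<sigma>\<close> at that level.
\<close>

lemma integral_desc:
  assumes "Harm f" "f \<in> L2_space M"
  shows "(LINT y:desc x|M. f y) = of_real (S (lev x) * m x) * f x"
proof -
  have "(LINT y:desc x|M. f y) = (\<Sum>n. LINT y:gen n x|M. f y)"
    using L2_integrable_desc[OF assms(2), of x] unfolding desc_def
    by (intro lebesgue_integral_countable_add) (auto simp: disjoint_gen)
  also have "(\<lambda>n. LINT y:gen n x|M. f y) = (\<lambda>n. of_real (\<sigma> (lev x - int n)) * (of_real (m x) * f x))"
  proof
    fix n
    have "(LINT y:gen n x|M. f y) = (\<Sum>y\<in>gen n x. of_real (\<sigma> (lev x - int n)) * (of_real (m y) * f y))"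
      unfolding integral_finite[OF finite_gen]
      by (intro sum.cong) (auto simp: lev_gen scaleR_conv_of_real)
    then show "(LINT y:gen n x|M. f y) = of_real (\<sigma> (lev x - int n)) * (of_real (m x) * f x)"
      by (simp add: sum_distrib_left[symmetric] Harm_gen[OF assms(1)])
  qed
  also have "(\<Sum>n. of_real (\<sigma> (lev x - int n)) * (of_real (m x) * f x)) = of_real (S (lev x)) * (of_real (m x) * f x)"
    unfolding S_def using \<sigma>_summable
    by (simp add: suminf_mult2[symmetric] summable_of_real suminf_of_real)
  finally show ?thesis by simp
qed

lemma S_Suc: "S (n + 1) = S n + \<sigma> (n + 1)"
proof -
  have "S (n + 1) = \<sigma> (n + 1 - int 0) + (\<Sum>k. \<sigma> (n + 1 - int (Suc k)))"
    unfolding S_def using suminf_split_head[OF \<sigma>_summable[of "n + 1"]] by simp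
  then show ?thesis by (simp add: S_def algebra_simps)
qed

lemma S_pos: "0 < S n"
  unfolding S_def by (rule suminf_pos[OF \<sigma>_summable \<sigma>_pos])

lemma S_mono_nat: "S n \<le> S (n + int k)"
proof (induction k)
  case (Suc k)
  have "n + int (Suc k) = n + int k + 1" by simp
  then have "S (n + int (Suc k)) = S (n + int k) + \<sigma> (n + int k + 1)" by (simp only: S_Suc)
  with Suc show ?case using \<sigma>_nonneg[of "n + int k + 1"] by linarith
qed simp

text \<open>
  The indicator of a subtree fails to be harmonic only at the parent of its root, and there by the flow
  through the root. The indicator of the root alone has the same defect, so removing \<open>par z\<close> from its
  subtree moves the defect of the second summand to \<open>par z\<close>, where it cancels that of the first.
\<close>

lemma Harm_bump: "Harm (\<lambda>y. of_real (bump z y))"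
  unfolding Harm_def
proof
  fix x
  have ind: "(\<Sum>y | par y = x. m y * indicator (desc w) y)
      = m x * indicator (desc w) x + (if par w = x then m w else 0)" for w :: 'a
  proof -
    have "indicator (desc w) y = indicator (desc w) x + (if w = y then 1 else 0 :: real)"
      if "par y = x" for y
      using that desc_par[of y w] par_notin_desc[of w] by (auto split: split_indicator)
    then have "(\<Sum>y | par y = x. m y * indicator (desc w) y)
       = (\<Sum>y | par y = x. m y * indicator (desc w) x + (if w = y then m y else 0))"
      by (intro sum.cong) (auto simp: algebra_simps)
    also have "\<dots> = m x * indicator (desc w) x + (if par w = x then m w else 0)"
      by (simp add: finite_children flow[of x, symmetric] sum.distrib sum.delta' sum_distrib_right[symmetric])
    finally show ?thesis .
  qed
  have sing: "(\<Sum>y | par y = x. m y * indicator {w} y) = (if par w = x then m w else 0)" for w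
    using finite_children
    by (simp add: indicator_def if_distrib[of "\<lambda>c. m _ * c"] sum.delta cong: if_cong)
  have diff: "indicator (desc w - {w}) y = indicator (desc w) y - (indicator {w} y :: real)" for w y
    using desc_self[of w] by (auto split: split_indicator)
  have "(\<Sum>y | par y = x. m y * bump z y)
    = (\<Sum>y | par y = x. m y * indicator (desc z) y) / m z
      - ((\<Sum>y | par y = x. m y * indicator (desc (par z)) y)
        - (\<Sum>y | par y = x. m y * indicator {par z} y)) / m (par z)"
    unfolding bump_def diff
    by (simp add: sum_subtractf[symmetric] sum_divide_distrib algebra_simps diff_divide_distrib)
  also have "\<dots> = m x * bump z x"
    unfolding ind sing bump_def diff by (auto simp: field_simps split: split_indicator)
  finally show "complex_of_real (m x) * of_real (bump z x) = (\<Sum>y | par y = x. complex_of_real (m y) * of_real (bump z y))"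
    by (simp flip: of_real_mult of_real_sum)
qed

lemma L2_bump: "(\<lambda>y. of_real (bump z y)) \<in> L2_space M"
proof -
  have "integrable M (\<lambda>y. (bump z y)\<^sup>2)"
  proof (rule Bochner_Integration.integrable_bound)
    show "integrable M (\<lambda>y. (1 / m z + 1 / m (par z))\<^sup>2 * indicator (desc (par z)) y)"
      using finite_measure_desc[of "par z"] by (simp add: integrable_indicator_iff)
    have "\<bar>bump z y\<bar> \<le> (1 / m z + 1 / m (par z)) * indicator (desc (par z)) y" for y
      using desc_subset_par[of z] abs_triangle_ineq4[of "1 / m z" "1 / m (par z)"]
      by (auto simp: bump_def split: split_indicator)
    then have "\<bar>bump z y\<bar>\<^sup>2 \<le> ((1 / m z + 1 / m (par z)) * indicator (desc (par z)) y)\<^sup>2" for y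
      by (intro power_mono) auto
    then have "(bump z y)\<^sup>2 \<le> (1 / m z + 1 / m (par z))\<^sup>2 * indicator (desc (par z)) y" for y
      by (simp add: power_mult_distrib power2_eq_square[of "indicator _ _"] flip: indicator_inter_arith)
    then show "AE y in M. norm ((bump z y)\<^sup>2) \<le> norm ((1 / m z + 1 / m (par z))\<^sup>2 * indicator (desc (par z)) y)"
      by simp
  qed simp
  then show ?thesis by (simp add: L2_space_def)
qed

text \<open>
  Removing the vertex \<open>par z\<close> turns the factor \<open>S(\<ell>(par z))\<close> in the integral over its subtree into
  \<open>S(\<ell>(z))\<close>. Both parts of the bump then carry the same weight, and the difference of \<open>f\<close> factors out.
\<close>

lemma inner_bump:
  assumes "Harm f" "f \<in> L2_space M"
  shows "L2_inner M f (\<lambda>y. of_real (bump z y)) = of_real (S (lev z)) * (f z - f (par z))"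
proof -
  let ?w = "par z"
  have int: "set_integrable M (desc z) f" "set_integrable M (desc ?w) f" "set_integrable M {?w} f"
    using L2_integrable_desc[OF assms(2)]
    by (auto intro: set_integrable_subset[OF L2_integrable_desc[OF assms(2), of ?w]] desc_self)
  have diff: "indicator (desc ?w - {?w}) y = indicator (desc ?w) y - (indicator {?w} y :: real)" for y
    using desc_self[of ?w] by (auto split: split_indicator)
  have "L2_inner M f (\<lambda>y. of_real (bump z y)) =
     (\<integral>y. (indicator (desc z) y *\<^sub>R f y) / of_real (m z) - ((indicator (desc ?w) y *\<^sub>R f y)
        - (indicator {?w} y *\<^sub>R f y)) / of_real (m ?w) \<partial>M)"
    unfolding L2_inner_def bump_def diff
    by (intro Bochner_Integration.integral_cong)
      (auto simp: scaleR_conv_of_real algebra_simps diff_divide_distrib)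
  also have "\<dots> = (LINT y:desc z|M. f y) / of_real (m z) - ((LINT y:desc ?w|M. f y) - (LINT y:{?w}|M. f y)) / of_real (m ?w)"
    using int unfolding set_lebesgue_integral_def set_integrable_def by simp
  also have "\<dots> = of_real (S (lev z) * m z) * f z / of_real (m z)
       - (of_real (S (lev ?w) * m ?w) * f ?w - of_real (m ?w * \<sigma> (lev ?w)) * f ?w) / of_real (m ?w)"
    by (simp add: integral_desc[OF assms] integral_finite scaleR_conv_of_real)
  also have "\<dots> = of_real (S (lev z)) * (f z - f ?w)"
  proof -
    have "S (lev ?w) = S (lev z) + \<sigma> (lev ?w)" by (simp add: lev_par S_Suc)
    then show ?thesis by (simp add: field_simps)
  qed
  finally show ?thesis .
qed

lemma lev_desc_antisym: "y \<in> desc x \<Longrightarrow> lev x \<le> lev y \<Longrightarrow> y = x"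
proof -
  assume "y \<in> desc x" and le: "lev x \<le> lev y"
  then obtain n where n: "y \<in> gen n x" by (auto simp: desc_def)
  with le lev_gen[OF n] have "n = 0" by simp
  then show ?thesis using n by (simp add: gen_0)
qed

lemma bump_inside: "y \<in> desc z \<Longrightarrow> bump z y = 1 / m z - 1 / m (par z)"
  using desc_subset_par[of z] par_notin_desc[of z] by (auto simp: bump_def split: split_indicator)

lemma bump_above: "lev z < lev y \<Longrightarrow> bump z y = 0"
  using lev_desc[of y z] lev_desc_antisym[of y "par z"]
  by (auto simp: bump_def lev_par split: split_indicator)

lemma m_le_par: "m x \<le> m (par x)"
  unfolding flow[of "par x"] by (rule member_le_sum) (auto simp: finite_children)

section \<open>The kernel and its partial sums\<close>

definition kterm :: "'a \<Rightarrow> nat \<Rightarrow> 'a \<Rightarrow> real" where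
  "kterm v n y = bump ((par ^^ n) v) y / S (lev v + int n)"

text \<open>
  The value of the \<open>n\<close>-th term of the kernel on the subtree below the \<open>n\<close>-th ancestor of \<open>v\<close>. It is also the
  squared norm of that term (\<open>norm_block\<close> for a block of length one).
\<close>

definition energy :: "'a \<Rightarrow> nat \<Rightarrow> real" where
  "energy v n = (1 / m ((par ^^ n) v) - 1 / m ((par ^^ Suc n) v)) / S (lev v + int n)"

lemma kterm_inside: "y \<in> desc ((par ^^ n) v) \<Longrightarrow> kterm v n y = energy v n"
  by (simp add: kterm_def energy_def bump_inside)

lemma energy_nonneg: "0 \<le> energy v n"
  unfolding energy_def using m_le_par[of "(par ^^ n) v"] S_pos[of "lev v + int n"] m_pos
  by (auto intro!: divide_nonneg_pos frac_le)

lemma summable_energy: "summable (energy v)"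
proof (rule bounded_imp_summable[OF energy_nonneg])
  fix n
  have "energy v k \<le> (1 / m ((par ^^ k) v) - 1 / m ((par ^^ Suc k) v)) / S (lev v)" for k
    unfolding energy_def using m_le_par[of "(par ^^ k) v"] S_pos[of "lev v"] S_mono_nat[of "lev v" k] m_pos
    by (intro divide_left_mono) (auto intro!: frac_le mult_pos_pos S_pos)
  then have "sum (energy v) {..n} \<le> (\<Sum>k\<le>n. (1 / m ((par ^^ k) v) - 1 / m ((par ^^ Suc k) v)) / S (lev v))"
    by (intro sum_mono)
  also have "\<dots> = (1 / m v - 1 / m ((par ^^ Suc n) v)) / S (lev v)"
    unfolding sum_divide_distrib[symmetric]
      sum_telescope[of "\<lambda>k. 1 / m ((par ^^ k) v)"] by simp
  also have "\<dots> \<le> 1 / m v / S (lev v)"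
    using S_pos[of "lev v"] by (intro divide_right_mono) auto
  finally show "sum (energy v) {..n} \<le> 1 / m v / S (lev v)" .
qed

text \<open>
  Every \<open>y\<close> lies below almost all ancestors of \<open>v\<close>, and there the terms take the constant values
  \<open>energy v n\<close>.
\<close>

lemma summable_kterm: "summable (\<lambda>n. kterm v n y)"
proof -
  obtain i j where ij: "(par ^^ i) y = (par ^^ j) v" using common_ancestor by blast
  have "kterm v n y = energy v n" if "j \<le> n" for n
  proof (rule kterm_inside)
    have "(par ^^ (n - j + j)) v = (par ^^ (n - j)) ((par ^^ j) v)"
      by (simp only: funpow_add o_apply)
    then have "(par ^^ n) v = (par ^^ (n - j)) ((par ^^ i) y)" using that ij by simp
    also have "\<dots> = (par ^^ (n - j + i)) y" by (simp add: funpow_add)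
    finally have "y \<in> gen (n - j + i) ((par ^^ n) v)" by (simp add: gen_def)
    then show "y \<in> desc ((par ^^ n) v)" unfolding desc_def by blast
  qed
  then have "eventually (\<lambda>n. kterm v n y = energy v n) sequentially"
    unfolding eventually_sequentially by blast
  from summable_cong[OF this] summable_energy show ?thesis by simp
qed

definition bergman :: "'a \<Rightarrow> 'a \<Rightarrow> real" where "bergman v y = (\<Sum>n. kterm v n y)"

lemma Harm_kterm: "Harm (\<lambda>y. of_real (kterm v n y))"
  unfolding Harm_def
proof
  fix x
  let ?z = "(par ^^ n) v" and ?s = "complex_of_real (S (lev v + int n))"
  have "of_real (m x) * complex_of_real (bump ?z x)
      = (\<Sum>y | par y = x. of_real (m y) * of_real (bump ?z y))"
    using Harm_bump[of ?z] unfolding Harm_def by blast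
  then have "(of_real (m x) * complex_of_real (bump ?z x)) / ?s
      = (\<Sum>y | par y = x. of_real (m y) * of_real (bump ?z y)) / ?s" by (rule arg_cong)
  then show "of_real (m x) * complex_of_real (kterm v n x)
      = (\<Sum>y | par y = x. of_real (m y) * of_real (kterm v n y))"
    by (simp add: kterm_def sum_divide_distrib)
qed

lemma L2_kterm: "(\<lambda>y. of_real (kterm v n y)) \<in> L2_space M"
  using L2_cmult[OF L2_bump, of "inverse (of_real (S (lev v + int n)))" "(par ^^ n) v"]
  by (simp add: kterm_def divide_inverse mult.commute)

lemma Harm_sum: "(\<And>n. n \<in> I \<Longrightarrow> Harm (g n)) \<Longrightarrow> Harm (\<lambda>y. \<Sum>n\<in>I. g n y)"
  unfolding Harm_def sum_distrib_left
proof
  fix x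
  assume H: "\<And>n. n \<in> I \<Longrightarrow> \<forall>x. of_real (m x) * g n x = (\<Sum>y | par y = x. of_real (m y) * g n y)"
  then have "(\<Sum>n\<in>I. of_real (m x) * g n x) = (\<Sum>n\<in>I. \<Sum>y | par y = x. of_real (m y) * g n y)"
    by (intro sum.cong refl) blast
  also have "\<dots> = (\<Sum>y | par y = x. \<Sum>n\<in>I. of_real (m y) * g n y)" by (rule sum.swap)
  finally show "(\<Sum>n\<in>I. of_real (m x) * g n x) = (\<Sum>y | par y = x. \<Sum>n\<in>I. of_real (m y) * g n y)" .
qed

lemma inner_kterm:
  assumes "Harm f" "f \<in> L2_space M"
  shows "L2_inner M f (\<lambda>y. of_real (kterm v n y)) = f ((par ^^ n) v) - f ((par ^^ Suc n) v)"
proof -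
  have "L2_inner M f (\<lambda>y. of_real (kterm v n y))
      = L2_inner M f (\<lambda>y. of_real (bump ((par ^^ n) v) y)) / of_real (S (lev v + int n))"
    unfolding L2_inner_def kterm_def by simp
  also have "\<dots> = f ((par ^^ n) v) - f ((par ^^ Suc n) v)"
    using inner_bump[OF assms, of "(par ^^ n) v"] S_pos[of "lev v + int n"] by (simp add: lev_funpow)
  finally show ?thesis .
qed

definition block :: "'a \<Rightarrow> nat \<Rightarrow> nat \<Rightarrow> 'a \<Rightarrow> real" where
  "block v i j y = (\<Sum>n=i..<j. kterm v n y)"

lemma Harm_block: "Harm (\<lambda>y. of_real (block v i j y))"
  unfolding block_def of_real_sum by (rule Harm_sum) (rule Harm_kterm)

lemma L2_block: "(\<lambda>y. of_real (block v i j y)) \<in> L2_space M"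
  unfolding block_def of_real_sum by (rule L2_sum) (rule L2_kterm)

lemma inner_block:
  assumes "Harm f" "f \<in> L2_space M" "i \<le> j"
  shows "L2_inner M f (\<lambda>y. of_real (block v i j y)) = f ((par ^^ i) v) - f ((par ^^ j) v)"
proof -
  have "L2_inner M f (\<lambda>y. of_real (block v i j y))
      = (\<Sum>n=i..<j. L2_inner M f (\<lambda>y. of_real (kterm v n y)))"
    unfolding L2_inner_def block_def of_real_sum cnj_sum sum_distrib_left
    by (rule Bochner_Integration.integral_sum) (intro integrable_mult_cnj_L2 assms L2_kterm)
  also have "\<dots> = (\<Sum>n=i..<j. - (f ((par ^^ Suc n) v) - f ((par ^^ n) v)))"
    unfolding inner_kterm[OF assms(1,2)] by simp
  also have "\<dots> = f ((par ^^ i) v) - f ((par ^^ j) v)"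
    unfolding sum_negf sum_Suc_diff'[OF assms(3), of "\<lambda>n. f ((par ^^ n) v)"] by simp
  finally show ?thesis .
qed

text \<open>
  By \<open>inner_block\<close> applied to the block itself, the squared norm is the difference of the values at the
  \<open>i\<close>-th and \<open>j\<close>-th ancestors. The first lies below all the ancestors involved; the second lies at or above
  the parents of all of them, where the bumps vanish.
\<close>

lemma norm_block:
  assumes "i \<le> j"
  shows "(\<integral>y. (block v i j y)\<^sup>2 \<partial>M) = (\<Sum>n=i..<j. energy v n)"
proof -
  have "complex_of_real (\<integral>y. (block v i j y)\<^sup>2 \<partial>M)
      = L2_inner M (\<lambda>y. of_real (block v i j y)) (\<lambda>y. of_real (block v i j y))"
    unfolding L2_inner_def by (simp add: power2_eq_square flip: of_real_mult)
  also have "\<dots> = of_real (block v i j ((par ^^ i) v) - block v i j ((par ^^ j) v))"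
    using inner_block[OF Harm_block L2_block assms] by simp
  also have "block v i j ((par ^^ i) v) = (\<Sum>n=i..<j. energy v n)"
    unfolding block_def
  proof (intro sum.cong refl kterm_inside)
    fix n assume "n \<in> {i..<j}"
    then show "(par ^^ i) v \<in> desc ((par ^^ n) v)" using funpow_in_desc[of i v "n - i"] by simp
  qed
  also have "block v i j ((par ^^ j) v) = 0"
    unfolding block_def kterm_def by (intro sum.neutral) (simp add: bump_above lev_funpow)
  finally show ?thesis by (simp only: of_real_eq_iff diff_0_right)
qed

text \<open>
  The remainder is the pointwise limit of blocks whose norms are bounded by the tail of a convergent
  series, so Fatou's lemma gives both integrability and the bound.
\<close>

lemma kernel_tail:
  shows L2_kernel_tail: "(\<lambda>y. of_real (bergman v y - block v 0 i y)) \<in> L2_space M" (is ?L2)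
    and norm_kernel_tail: "(\<integral>y. (bergman v y - block v 0 i y)\<^sup>2 \<partial>M) \<le> (\<Sum>n. energy v (n + i))" (is ?le)
proof -
  let ?R = "\<lambda>y. bergman v y - block v 0 i y" and ?t = "\<Sum>n. energy v (n + i)"
  have summ: "summable (\<lambda>n. energy v (n + i))" using summable_energy by (rule summable_ignore_initial_segment)
  have lim: "(\<lambda>k. block v i (i + k) y) \<longlonglongrightarrow> ?R y" for y
  proof -
    have "(\<lambda>n. kterm v (n + i) y) sums ?R y"
      unfolding bergman_def block_def atLeast0LessThan
      using summable_sums[OF summable_kterm] by (rule sums_split_initial_segment)
    moreover have "block v i (i + k) y = (\<Sum>n<k. kterm v (n + i) y)" for k
      unfolding block_def using sum.shift_bounds_nat_ivl[of "\<lambda>n. kterm v n y" 0 i k]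
      by (simp add: atLeast0LessThan add.commute)
    ultimately show ?thesis by (simp add: sums_def)
  qed
  have bound: "(\<integral>\<^sup>+y. ennreal ((block v i (i + k) y)\<^sup>2) \<partial>M) \<le> ennreal ?t" for k
  proof -
    have "integrable M (\<lambda>y. (block v i (i + k) y)\<^sup>2)"
      using L2_block[of v i "i + k"] by (simp add: L2_space_def)
    then have "(\<integral>\<^sup>+y. ennreal ((block v i (i + k) y)\<^sup>2) \<partial>M) = ennreal (\<Sum>n=i..<i + k. energy v n)"
      by (subst nn_integral_eq_integral) (simp_all add: norm_block)
    also have "(\<Sum>n=i..<i + k. energy v n) = (\<Sum>n<k. energy v (n + i))"
      using sum.shift_bounds_nat_ivl[of "energy v" 0 i k] by (simp add: atLeast0LessThan add.commute)
    also have "\<dots> \<le> ?t" by (rule sum_le_suminf[OF summ]) (auto simp: energy_nonneg)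
    finally show ?thesis by (simp add: ennreal_leI)
  qed
  have "(\<integral>\<^sup>+y. ennreal ((?R y)\<^sup>2) \<partial>M) = (\<integral>\<^sup>+y. liminf (\<lambda>k. ennreal ((block v i (i + k) y)\<^sup>2)) \<partial>M)"
    using lim by (intro nn_integral_cong lim_imp_Liminf[symmetric] tendsto_ennrealI tendsto_power) auto
  also have "\<dots> \<le> liminf (\<lambda>k. \<integral>\<^sup>+y. ennreal ((block v i (i + k) y)\<^sup>2) \<partial>M)"
    by (rule nn_integral_liminf) simp
  also have "\<dots> \<le> ennreal ?t"
    using bound by (intro Liminf_le) auto
  finally have le: "(\<integral>\<^sup>+y. ennreal ((?R y)\<^sup>2) \<partial>M) \<le> ennreal ?t" .
  have "integrable M (\<lambda>y. (?R y)\<^sup>2)"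
    by (rule integrableI_bounded) (use le in \<open>auto intro: le_less_trans\<close>)
  then show ?L2 by (simp add: L2_space_def flip: of_real_diff)
  have "0 \<le> ?t" using summ by (rule suminf_nonneg) (rule energy_nonneg)
  then show ?le using le by (rule integral_real_bounded)
qed

lemma L2_kernel: "(\<lambda>y. of_real (bergman v y)) \<in> L2_space M"
  using L2_kernel_tail[of v 0] by (simp add: block_def)

text \<open>
  Harmonicity is a finite linear condition at each vertex, so it passes to pointwise limits.
\<close>

lemma Harm_kernel: "Harm (\<lambda>y. of_real (bergman v y))"
  unfolding Harm_def
proof
  fix x
  let ?P = "\<lambda>k y. complex_of_real (block v 0 k y)"
  have lim: "(\<lambda>k. ?P k y) \<longlonglongrightarrow> of_real (bergman v y)" for y
    unfolding block_def atLeast0LessThan bergman_def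
    using summable_LIMSEQ[OF summable_kterm] by (rule tendsto_of_real)
  have "(\<lambda>k. of_real (m x) * ?P k x) \<longlonglongrightarrow> of_real (m x) * of_real (bergman v x)"
    by (intro tendsto_intros lim)
  moreover have "(\<lambda>k. \<Sum>y | par y = x. of_real (m y) * ?P k y)
      \<longlonglongrightarrow> (\<Sum>y | par y = x. of_real (m y) * of_real (bergman v y))"
    by (intro tendsto_intros lim)
  moreover have "of_real (m x) * ?P k x = (\<Sum>y | par y = x. of_real (m y) * ?P k y)" for k
    using Harm_block[of v 0 k] unfolding Harm_def by blast
  ultimately show "of_real (m x) * complex_of_real (bergman v x)
      = (\<Sum>y | par y = x. of_real (m y) * of_real (bergman v y))"
    using LIMSEQ_unique by simp
qed

lemma point_bound:
  assumes "f \<in> L2_space M"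
  shows "(cmod (f x))\<^sup>2 * (\<sigma> (lev x) * m x) \<le> (\<integral>y. (cmod (f y))\<^sup>2 \<partial>M)"
proof -
  have int: "integrable M (\<lambda>y. (cmod (f y))\<^sup>2)" using assms by (simp add: L2_space_def)
  have "(cmod (f x))\<^sup>2 * (\<sigma> (lev x) * m x) = (LINT y:{x}|M. (cmod (f y))\<^sup>2)"
    by (simp add: integral_finite)
  also have "\<dots> \<le> (\<integral>y. (cmod (f y))\<^sup>2 \<partial>M)"
    unfolding set_lebesgue_integral_def
    by (intro integral_mono integrable_mult_indicator int) (auto split: split_indicator)
  finally show ?thesis .
qed

text \<open>
  The mass of the \<open>n\<close>-th ancestor of \<open>b\<close> tends to infinity, while the contribution of each vertex to the
  norm of \<open>f\<close> stays bounded. Since any two vertices have a common ancestor, the statement for \<open>b\<close> implies the one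
  for every \<open>v\<close>.
\<close>

lemma L2_vanishes_along_ancestors:
  assumes lim: "(\<lambda>n. 1 / (\<sigma> (lev b + int n) * m ((par ^^ n) b))) \<longlonglongrightarrow> 0"
    and f: "f \<in> L2_space M"
  shows "(\<lambda>n. f ((par ^^ n) v)) \<longlonglongrightarrow> 0"
proof -
  have b: "(\<lambda>n. f ((par ^^ n) b)) \<longlonglongrightarrow> 0"
  proof -
    let ?C = "\<integral>y. (cmod (f y))\<^sup>2 \<partial>M"
    have "norm ((cmod (f ((par ^^ n) b)))\<^sup>2) \<le> ?C * (1 / (\<sigma> (lev b + int n) * m ((par ^^ n) b)))" for n
      using point_bound[OF f, of "(par ^^ n) b"] \<sigma>_pos[of "lev b + int n"] m_pos[of "(par ^^ n) b"]
      by (simp add: lev_funpow pos_le_divide_eq)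
    then have "eventually (\<lambda>n. norm ((cmod (f ((par ^^ n) b)))\<^sup>2)
        \<le> ?C * (1 / (\<sigma> (lev b + int n) * m ((par ^^ n) b)))) sequentially"
      by (rule always_eventually[OF allI])
    moreover have "(\<lambda>n. ?C * (1 / (\<sigma> (lev b + int n) * m ((par ^^ n) b)))) \<longlonglongrightarrow> 0"
      by (rule tendsto_mult_right_zero[OF lim])
    ultimately have "(\<lambda>n. (cmod (f ((par ^^ n) b)))\<^sup>2) \<longlonglongrightarrow> 0"
      by (rule Lim_null_comparison)
    then have "(\<lambda>n. sqrt ((cmod (f ((par ^^ n) b)))\<^sup>2)) \<longlonglongrightarrow> sqrt 0" by (rule tendsto_real_sqrt)
    then show ?thesis by (simp add: tendsto_norm_zero_iff)
  qed
  obtain i j where ij: "(par ^^ i) b = (par ^^ j) v" using common_ancestor by blast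
  have "(\<lambda>n. f ((par ^^ (n + j)) v)) = (\<lambda>n. f ((par ^^ (n + i)) b))"
    by (simp add: funpow_add ij)
  then have "(\<lambda>n. f ((par ^^ (n + j)) v)) \<longlonglongrightarrow> 0"
    using LIMSEQ_ignore_initial_segment[OF b, of i] by simp
  then show ?thesis by (rule LIMSEQ_offset)
qed

theorem kernel_reproducing:
  assumes lim: "(\<lambda>n. 1 / (\<sigma> (lev b + int n) * m ((par ^^ n) b))) \<longlonglongrightarrow> 0"
    and f: "Harm f" "f \<in> L2_space M"
  shows "L2_inner M f (\<lambda>y. of_real (bergman v y)) = f v"
proof -
  let ?I = "L2_inner M f (\<lambda>y. of_real (bergman v y))" and ?C = "\<integral>y. (cmod (f y))\<^sup>2 \<partial>M"
  have bound: "cmod (?I - f v) \<le> t * ?C" if t: "0 < t" for t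
  proof (rule LIMSEQ_le_const)
    have "(\<lambda>i. t * ?C + (\<Sum>n. energy v (n + i)) / t + cmod (f ((par ^^ i) v))) \<longlonglongrightarrow> t * ?C + 0 / t + cmod 0"
      using t by (intro tendsto_intros L2_vanishes_along_ancestors[OF lim f(2)] suminf_exist_split2 summable_energy) simp
    then show "(\<lambda>i. t * ?C + (\<Sum>n. energy v (n + i)) / t + cmod (f ((par ^^ i) v))) \<longlonglongrightarrow> t * ?C"
      by simp
    \<comment> \<open>the kernel is split after \<open>i\<close> terms: the head telescopes, the tail is small in norm\<close>
    have "cmod (?I - f v) \<le> t * ?C + (\<Sum>n. energy v (n + i)) / t + cmod (f ((par ^^ i) v))" for i
    proof -
      let ?R = "\<lambda>y. complex_of_real (bergman v y - block v 0 i y)"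
      have "L2_inner M f ?R = ?I - L2_inner M f (\<lambda>y. of_real (block v 0 i y))"
        unfolding L2_inner_def of_real_diff complex_cnj_diff right_diff_distrib
        by (intro Bochner_Integration.integral_diff integrable_mult_cnj_L2 f L2_kernel L2_block)
      also have "\<dots> = ?I - (f v - f ((par ^^ i) v))"
        using inner_block[OF f, of 0 i v] by simp
      finally have "?I - f v = L2_inner M f ?R - f ((par ^^ i) v)" by simp
      then have "cmod (?I - f v) \<le> cmod (L2_inner M f ?R) + cmod (f ((par ^^ i) v))"
        by (simp only: norm_triangle_ineq4)
      also have "cmod (L2_inner M f ?R) \<le> t * ?C + (\<integral>y. (cmod (?R y))\<^sup>2 \<partial>M) / t"
        by (rule L2_inner_bound[OF f(2) L2_kernel_tail t])
      also have "(\<integral>y. (cmod (?R y))\<^sup>2 \<partial>M) \<le> (\<Sum>n. energy v (n + i))"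
        using norm_kernel_tail[of v i] by (simp only: norm_of_real power2_abs)
      finally show ?thesis using t by (simp add: divide_right_mono)
    qed
    then show "\<exists>N. \<forall>i\<ge>N. cmod (?I - f v) \<le> t * ?C + (\<Sum>n. energy v (n + i)) / t + cmod (f ((par ^^ i) v))"
      by blast
  qed
  have "(\<lambda>t. t * ?C) \<midarrow>0\<rightarrow> 0 * ?C" by (intro tendsto_intros)
  then have "((\<lambda>t. t * ?C) \<longlongrightarrow> 0) (at_right 0)"
    by (simp add: filterlim_at_split)
  then have "cmod (?I - f v) \<le> 0"
    by (rule tendsto_lowerbound) (auto simp: eventually_at_right_less bound eventually_at_filter)
  then show ?thesis by simp
qed

end

section \<open>The kernel of the tree\<close>

locale bergman_tree = rooted_tree E x0 \<omega>
  for E :: "'a \<Rightarrow> 'a \<Rightarrow> bool" and x0 :: 'a and \<omega> :: "(nat \<Rightarrow> 'a) set" +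
  fixes m :: "'a \<Rightarrow> real" and \<sigma> :: "int \<Rightarrow> real"
  assumes locally_finite: "locally_finite E"
    and flow_measure: "flow_measure E \<omega> m"
    and sigma_pos: "\<forall>n. 0 < \<sigma> n"
    and sigma_summable_on: "\<forall>k. \<sigma> summable_on {..k}"

sublocale bergman_tree \<subseteq> horocyclic_flow par lev m \<sigma>
proof
  fix x y :: 'a and n :: int
  show "lev (par x) = lev x + 1" by (rule level_parent)
  have "succs E \<omega> x \<subseteq> {y. E x y}" by (auto simp: succs_def)
  then show "finite {y. par y = x}"
    unfolding succs_eq[symmetric] using locally_finite finite_subset by (auto simp: locally_finite_def)
  show "\<exists>i j. (par ^^ i) x = (par ^^ j) y" by (rule tree_common_ancestor)
  show "0 < m x" and "m x = (\<Sum>y | par y = x. m y)"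
    using flow_measure unfolding flow_measure_def succs_eq by blast+
  show "0 < \<sigma> n" using sigma_pos by blast
  have "bij_betw (\<lambda>k. n - int k) UNIV {..n}"
    by (rule bij_betw_byWitness[where f' = "\<lambda>i. nat (n - i)"]) auto
  then have "(\<lambda>k. \<sigma> (n - int k)) summable_on UNIV"
    using sigma_summable_on by (subst summable_on_reindex_bij_betw) auto
  then show "summable (\<lambda>k. \<sigma> (n - int k))" by (rule summable_on_imp_summable)
qed

context bergman_tree
begin

lemma subtree_eq_desc: "subtree E \<omega> x = desc x"
  by (simp add: subtree_def nsuccs_eq desc_def gen_def)

lemma weighted_measure_eq: "weighted_measure E \<omega> m \<sigma> = M"
  by (simp add: weighted_measure_def M_def)

lemma level_sum_eq: "level_sum E \<omega> \<sigma> n x = S (lev x + n)"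
  by (simp add: level_sum_def S_def)

lemma harmonic_iff: "harmonic E \<omega> m f \<longleftrightarrow> Harm f"
proof -
  have "forward_laplacian E \<omega> m f x = 0
      \<longleftrightarrow> of_real (m x) * f x = (\<Sum>y | par y = x. of_real (m y) * f y)" for x
  proof -
    have avg: "(\<Sum>y | par y = x. f y * complex_of_real (m y / m x))
        = (\<Sum>y | par y = x. of_real (m y) * f y) / of_real (m x)"
      by (simp add: sum_divide_distrib mult.commute)
    show ?thesis
      unfolding forward_laplacian_def succs_eq avg by (auto simp: field_simps)
  qed
  then show ?thesis by (simp add: harmonic_def Harm_def)
qed

text \<open>
  A successor \<open>u\<close> of \<open>par z\<close> whose subtree contains \<open>z\<close> has the level of \<open>z\<close>, hence is \<open>z\<close>. So the case
  distinction defining \<open>\<Psi>\<close> asks whether \<open>y\<close> lies below \<open>z\<close>, elsewhere strictly below \<open>par z\<close>, or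
  neither.
\<close>

lemma Psi_eq_bump: "Psi E \<omega> m (par z) z y = bump z y"
proof -
  have z: "z \<in> desc (par z)" "z \<noteq> par z" "par z \<noteq> z"
    using desc_subset_par[of z] desc_self[of z] par_notin_desc[of z] by auto
  have child: "u = z" if "par u = par z" "z \<in> desc u" for u
    using lev_desc_antisym[of z u] that level_parent[of u] level_parent[of z] by simp
  show ?thesis
  proof (cases "y \<in> desc (par z) - {par z}")
    case False
    then have "y \<notin> desc z" using desc_subset_par[of z] par_notin_desc[of z] by auto
    with False show ?thesis
      by (auto simp: Psi_def proper_subtree_def subtree_eq_desc bump_def)
  next
    case True
    have in_branch: "u \<in> succs E \<omega> (par z) \<and> {y, z} \<subseteq> desc u \<longleftrightarrow> u = z \<and> y \<in> desc z" for u
      using child[of u] desc_self[of z] by (auto simp: succs_eq)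
    have "(\<exists>u\<in>succs E \<omega> (par z). {y, z} \<subseteq> desc u) \<longleftrightarrow> y \<in> desc z"
      unfolding Bex_def in_branch by blast
    moreover have "(THE u. u \<in> succs E \<omega> (par z) \<and> {y, z} \<subseteq> desc u) = z" if "y \<in> desc z"
      unfolding in_branch using that by blast
    moreover have "{y, z} \<subseteq> desc (par z) - {par z}" using True z by blast
    ultimately show ?thesis
      using True by (simp add: Psi_def proper_subtree_def subtree_eq_desc bump_def)
  qed
qed

lemma kernel_term_eq: "kernel_term E \<omega> m \<sigma> x y = (\<lambda>n. kterm x n y)"
  by (simp add: kernel_term_def kterm_def level_sum_eq Psi_eq_bump fun_eq_iff)

lemma bergman_kernel_eq: "bergman_kernel E \<omega> m \<sigma> x y = bergman x y"
  by (simp add: bergman_kernel_def bergman_def kernel_term_eq)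

lemma harmonic_bergman_eq: "f \<in> harmonic_bergman E \<omega> m \<sigma> \<longleftrightarrow> Harm f \<and> f \<in> L2_space M"
  by (simp add: harmonic_bergman_def harmonic_iff weighted_measure_eq)

end

theorem proposition2p10:
  fixes E :: "'a \<Rightarrow> 'a \<Rightarrow> bool" and x0 :: 'a and \<omega> :: "(nat \<Rightarrow> 'a) set"
    and m :: "'a \<Rightarrow> real" and \<sigma> :: "int \<Rightarrow> real"
  assumes "infinite (UNIV :: 'a set)"
    and "graph_tree E"
    and "locally_finite E"
    and "\<omega> \<in> tree_boundary E x0"
    and "\<forall>x. succs E \<omega> x \<noteq> {}"
    and "flow_measure E \<omega> m"
    and "\<forall>n. 0 < \<sigma> n"
    and "\<forall>k. \<sigma> summable_on {..k}"
    and "summable (\<lambda>n. 1 / (\<sigma> (int n) * m ((parent E \<omega> ^^ n) x0)))"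
  shows "(\<forall>x y. summable (kernel_term E \<omega> m \<sigma> x y)) \<and>
         (\<forall>v. (\<lambda>y. complex_of_real (bergman_kernel E \<omega> m \<sigma> v y)) \<in> harmonic_bergman E \<omega> m \<sigma> \<and>
              (\<forall>f \<in> harmonic_bergman E \<omega> m \<sigma>.
                 L2_inner (weighted_measure E \<omega> m \<sigma>) f
                   (\<lambda>y. complex_of_real (bergman_kernel E \<omega> m \<sigma> v y)) = f v))"
proof -
  interpret bergman_tree E x0 \<omega> m \<sigma>
    using assms by unfold_locales auto
  \<comment> \<open>the \<open>n\<close>-th ancestor of the reference vertex has level \<open>n\<close>\<close>
  have "(\<lambda>n. 1 / (\<sigma> (lev x0 + int n) * m ((par ^^ n) x0))) \<longlonglongrightarrow> 0"
    using summable_LIMSEQ_zero[OF assms(9)] by (simp add: level_x0)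
  note repr = kernel_reproducing[OF this]
  show ?thesis
    using summable_kterm Harm_kernel L2_kernel repr
    by (simp add: kernel_term_eq bergman_kernel_eq harmonic_bergman_eq weighted_measure_eq)
qed

end
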